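(* Let $S=[S_{ij}]$ be an $n\times n$ operator matrix with $S_{ij}\in\mathcal{B}_A(\mathcal{H})$ for $1\le i,j\le n$. Then $$w_{\mathbb{A}}\left(\begin{bmatrix} S_{11}&S_{12}&\cdots&S_{1n}\\ S_{21}&S_{22}&\cdots&S_{2n}\\ \vdots&\vdots&\ddots&\vdots\\ S_{n1}&S_{n2}&\cdots&S_{nn}\end{bmatrix}\right)\le\frac12\sum_{i=1}^n\left\{w_A(S_{ii})+\sqrt{w_A^2(S_{ii})+4\sum_{j=i+1}^n w_{\mathbb{A}}^2\left(\begin{bmatrix}O&S_{ij}\\ S_{ji}&O\end{bmatrix}\right)}\right\}.$$
   Context: $\mathcal{H}$ is a complex Hilbert space with inner product $\langle\cdot,\cdot\rangle$, $\mathcal{B}(\mathcal{H})$ is the algebra of bounded linear operators on $\mathcal{H}$, and $A\in\mathcal{B}(\mathcal{H})$ is a fixed positive operator ($\langle Ax,x\rangle\ge 0$ for all $x$). Put $\langle x,y\rangle_A=\langle Ax,y\rangle$ and $\|x\|_A=\sqrt{\langle x,x\rangle_A}$. $\mathcal{B}_A(\mathcal{H})$ is the set of $T\in\mathcal{B}(\mathcal{H})$ admitting an $A$-adjoint, i.e. for which there is $X\in\mathcal{B}(\mathcal{H})$ with $AX=T^*A$ (equivalently $\mathcal{R}(T^*A)\subseteq\mathcal{R}(A)$). The $A$-numerical radius is $w_A(T)=\sup\{|\langle Tx,x\rangle_A|: x\in\mathcal{H},\ \|x\|_A=1\}$. For an $m\times m$ operator matrix acting on $\bigoplus_{i=1}^m\mathcal{H}$,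 $\mathbb{A}$ denotes the $m\times m$ block diagonal operator matrix all of whose diagonal entries are $A$ (the size $m$ being that of the matrix in question), and $w_{\mathbb{A}}$ is the numerical radius defined in the same way with $\mathcal{H},A$ replaced by $\bigoplus_{i=1}^m\mathcal{H},\mathbb{A}$. $w_A^2(\cdot)$ means $(w_A(\cdot))^2$; empty sums are $0$. *)

theory Defs
  imports "HOL-Analysis.Analysis"
begin

section \<open>Complex Hilbert spaces\<close>

text \<open>
  The metric, norm and completeness come from the underlying real Hilbert space, whose inner
  product is the real part of the complex one. \<open>cinner\<close> is linear in its first argument.
  Positive definiteness of \<open>cinner\<close> follows from \<open>inner_eq_Re_cinner\<close> and \<open>cinner_commute\<close>.
\<close>

class chilbert_space = real_inner + complete_space +
  fixes scaleC :: "complex \<Rightarrow> 'a \<Rightarrow> 'a" (infixr \<open>*\<^sub>C\<close> 75)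
    and cinner :: "'a \<Rightarrow> 'a \<Rightarrow> complex"
  assumes scaleC_add_right: "c *\<^sub>C (x + y) = c *\<^sub>C x + c *\<^sub>C y"
    and scaleC_add_left: "(c + d) *\<^sub>C x = c *\<^sub>C x + d *\<^sub>C x"
    and scaleC_scaleC: "c *\<^sub>C d *\<^sub>C x = (c * d) *\<^sub>C x"
    and scaleC_one: "1 *\<^sub>C x = x"
    and scaleR_eq_scaleC: "r *\<^sub>R x = complex_of_real r *\<^sub>C x"
    and cinner_add_left: "cinner (x + y) z = cinner x z + cinner y z"
    and cinner_scaleC_left: "cinner (c *\<^sub>C x) y = c * cinner x y"
    and cinner_commute: "cinner x y = cnj (cinner y x)"
    and inner_eq_Re_cinner: "inner x y = Re (cinner x y)"

instantiation complex :: chilbert_space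
begin

definition scaleC_complex :: "complex \<Rightarrow> complex \<Rightarrow> complex"
  where "scaleC_complex c x = c * x"

definition cinner_complex :: "complex \<Rightarrow> complex \<Rightarrow> complex"
  where "cinner_complex x y = x * cnj y"

instance
  by standard (auto simp: scaleC_complex_def cinner_complex_def algebra_simps
      scaleR_conv_of_real inner_complex_def)

end

text \<open>The direct sum of copies of a Hilbert space, indexed by a finite type.\<close>

instantiation vec :: (chilbert_space, finite) chilbert_space
begin

definition scaleC_vec :: "complex \<Rightarrow> 'a ^ 'b \<Rightarrow> 'a ^ 'b"
  where "scaleC_vec c x = (\<chi> i. c *\<^sub>C x $ i)"

definition cinner_vec :: "'a ^ 'b \<Rightarrow> 'a ^ 'b \<Rightarrow> complex"
  where "cinner_vec x y = (\<Sum>i\<in>UNIV. cinner (x $ i) (y $ i))"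

instance
proof
  fix x y z :: "'a ^ 'b" and c d :: complex and r :: real
  show "c *\<^sub>C (x + y) = c *\<^sub>C x + c *\<^sub>C y"
    by (simp add: scaleC_vec_def vec_eq_iff scaleC_add_right)
  show "(c + d) *\<^sub>C x = c *\<^sub>C x + d *\<^sub>C x"
    by (simp add: scaleC_vec_def vec_eq_iff scaleC_add_left)
  show "c *\<^sub>C d *\<^sub>C x = (c * d) *\<^sub>C x"
    by (simp add: scaleC_vec_def vec_eq_iff scaleC_scaleC)
  show "1 *\<^sub>C x = x"
    by (simp add: scaleC_vec_def vec_eq_iff scaleC_one)
  show "r *\<^sub>R x = complex_of_real r *\<^sub>C x"
    by (simp add: scaleC_vec_def vec_eq_iff scaleR_eq_scaleC)
  show "cinner (x + y) z = cinner x z + cinner y z"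
    by (simp add: cinner_vec_def cinner_add_left sum.distrib)
  show "cinner (c *\<^sub>C x) y = c * cinner x y"
    by (simp add: cinner_vec_def scaleC_vec_def cinner_scaleC_left sum_distrib_left)
  show "cinner x y = cnj (cinner y x)"
    unfolding cinner_vec_def cnj_sum by (rule sum.cong) (auto intro: cinner_commute)
  show "inner x y = Re (cinner x y)"
    by (simp add: cinner_vec_def inner_vec_def inner_eq_Re_cinner)
qed

end


section \<open>Bounded operators and adjoints\<close>

definition bounded_operator :: "('a::chilbert_space \<Rightarrow> 'a) \<Rightarrow> bool"
  where "bounded_operator T \<longleftrightarrow> bounded_linear T \<and> (\<forall>c x. T (c *\<^sub>C x) = c *\<^sub>C T x)"

definition positive_operator :: "('a::chilbert_space \<Rightarrow> 'a) \<Rightarrow> bool"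
  where "positive_operator A \<longleftrightarrow>
    bounded_operator A \<and> (\<forall>x. cinner (A x) x \<in> \<real> \<and> 0 \<le> Re (cinner (A x) x))"

text \<open>Existence and uniqueness, for bounded operators, are shown in \<open>cadjoint\<close> below.\<close>

definition cadjoint :: "('a::chilbert_space \<Rightarrow> 'a) \<Rightarrow> 'a \<Rightarrow> 'a"
  where "cadjoint T = (THE R. \<forall>x y. cinner (T x) y = cinner x (R y))"

definition A_adjointable :: "('a::chilbert_space \<Rightarrow> 'a) \<Rightarrow> ('a \<Rightarrow> 'a) set"
  where "A_adjointable A =
    {T. bounded_operator T \<and> (\<exists>X. bounded_operator X \<and> A \<circ> X = cadjoint T \<circ> A)}"


subsection \<open>Existence of the adjoint\<close>

lemma cinner_add_right: "cinner x (y + z) = cinner x y + cinner x (z::'a::chilbert_space)"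
  by (metis cinner_add_left cinner_commute complex_cnj_add)

lemma cinner_scaleC_right: "cinner x (c *\<^sub>C y) = cnj c * cinner x (y::'a::chilbert_space)"
  by (metis cinner_scaleC_left cinner_commute complex_cnj_mult)

lemma Im_cinner: "Im (cinner x y) = inner x (\<i> *\<^sub>C (y::'a::chilbert_space))"
  by (simp add: inner_eq_Re_cinner cinner_scaleC_right)

lemma cinner_eqI:
  assumes "\<And>x. cinner x y = cinner x (z::'a::chilbert_space)"
  shows "y = z"
proof -
  have "inner x y = inner x z" for x
    using assms by (simp add: inner_eq_Re_cinner)
  then have "inner (y - z) (y - z) = 0"
    by (simp add: inner_diff_right)
  then show ?thesis by simp
qed

text \<open>
  Riesz representation: minimise the energy \<open>J x = (norm x)\<^sup>2 - 2 * f x\<close>. The parallelogram law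
  makes minimising sequences Cauchy, and the minimiser represents \<open>f\<close>.
\<close>

lemma riesz_real:
  fixes f :: "'a::{real_inner, complete_space} \<Rightarrow> real"
  assumes f: "bounded_linear f"
  shows "\<exists>z. \<forall>x. f x = inner x z"
proof -
  interpret f: bounded_linear f by (rule f)
  define J where "J x = (norm x)\<^sup>2 - 2 * f x" for x
  obtain K where K: "\<And>x. \<bar>f x\<bar> \<le> norm x * K"
    using f.bounded by auto
  have lower: "- K\<^sup>2 \<le> J x" for x
  proof -
    have "0 \<le> (norm x - K)\<^sup>2" by simp
    then show ?thesis using K[of x] by (auto simp: J_def power2_diff)
  qed
  define m where "m = Inf (range J)"
  have bdd: "bdd_below (range J)" by (rule bdd_belowI[of _ "- K\<^sup>2"]) (use lower in auto)
  have mle: "m \<le> J x" for x unfolding m_def by (rule cInf_lower[OF _ bdd]) auto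
  have "\<exists>x. J x < m + inverse (real (Suc n))" for n
  proof -
    have "Inf (range J) < m + inverse (real (Suc n))" by (simp add: m_def)
    then show ?thesis using cInf_less_iff[OF _ bdd] by auto
  qed
  then obtain X where X: "\<And>n. J (X n) < m + inverse (real (Suc n))" by metis
  have par: "(norm (x - y))\<^sup>2 = 2 * J x + 2 * J y - 4 * J ((1/2) *\<^sub>R (x + y))" for x y
    unfolding J_def
    by (simp add: f.scaleR f.add power2_norm_eq_inner inner_add_left inner_add_right
        inner_diff_left inner_diff_right inner_commute algebra_simps)
  have close: "(norm (X i - X j))\<^sup>2 \<le> 4 * inverse (real (Suc N))" if "N \<le> i" "N \<le> j" for i j N
  proof -
    have a: "J (X k) < m + inverse (real (Suc N))" if "N \<le> k" for k
    proof -
      have "inverse (real (Suc k)) \<le> inverse (real (Suc N))"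
        using that by (intro le_imp_inverse_le) auto
      then show ?thesis using X[of k] by linarith
    qed
    show ?thesis
      using par[of "X i" "X j"] a[OF that(1)] a[OF that(2)] mle[of "(1/2) *\<^sub>R (X i + X j)"]
      by linarith
  qed
  have "Cauchy X"
  proof (rule metric_CauchyI)
    fix e :: real assume e: "0 < e"
    then obtain N where N: "inverse (real (Suc N)) < e\<^sup>2 / 4"
      using reals_Archimedean[of "e\<^sup>2 / 4"] by auto
    have "dist (X i) (X j) < e" if "N \<le> i" "N \<le> j" for i j
    proof -
      have "(norm (X i - X j))\<^sup>2 < e\<^sup>2" using close[OF that] N by linarith
      then show ?thesis using e by (simp add: dist_norm power_less_imp_less_base)
    qed
    then show "\<exists>M. \<forall>i\<ge>M. \<forall>j\<ge>M. dist (X i) (X j) < e" by blast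
  qed
  then obtain z where z: "X \<longlonglongrightarrow> z"
    using Cauchy_convergent convergent_def by blast
  have "(\<lambda>n. J (X n)) \<longlonglongrightarrow> J z"
    unfolding J_def by (intro tendsto_intros f.tendsto z)
  moreover have "(\<lambda>n. m + inverse (real (Suc n))) \<longlonglongrightarrow> m + 0"
    by (intro tendsto_intros LIMSEQ_inverse_real_of_nat)
  ultimately have Jz: "J z \<le> m"
    using X by (metis (no_types, lifting) LIMSEQ_le add_0_right less_imp_le)
  have "f x = inner x z" for x
  proof (cases "x = 0")
    case True then show ?thesis by (simp add: f.zero)
  next
    case False
    define a where "a = inner x z - f x"
    define q where "q = inner x x"
    have q: "q > 0" using False by (simp add: q_def)
    define t where "t = - a / q"
    have "(norm (z + t *\<^sub>R x))\<^sup>2 = (norm z)\<^sup>2 + 2 * t * inner x z + t * t * q"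
      unfolding q_def
      by (simp only: power2_norm_eq_inner)
        (simp add: inner_add_left inner_add_right inner_commute algebra_simps)
    then have "J (z + t *\<^sub>R x) = J z + 2 * t * a + t\<^sup>2 * q"
      by (simp add: J_def a_def f.scaleR f.add algebra_simps power2_eq_square)
    then have "0 \<le> 2 * t * a + t\<^sup>2 * q" using Jz mle[of "z + t *\<^sub>R x"] by linarith
    also have "\<dots> = - (a\<^sup>2 / q)" using q by (simp add: t_def field_simps power2_eq_square)
    finally have "a\<^sup>2 \<le> 0" using q by (simp add: field_simps)
    then show ?thesis by (simp add: a_def)
  qed
  then show ?thesis by blast
qed

lemma cadjoint:
  assumes T: "bounded_operator T"
  shows "cinner (T x) y = cinner x (cadjoint T y)"
proof -
  have bl: "bounded_linear T" and sc: "\<And>c x. T (c *\<^sub>C x) = c *\<^sub>C T x"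
    using T by (auto simp: bounded_operator_def)
  have "\<exists>z. \<forall>x. inner (T x) y = inner x z" for y
    by (rule riesz_real)
      (rule bounded_linear_compose[OF bounded_linear_inner_left bl])
  then obtain R where R: "\<And>x y. inner (T x) y = inner x (R y)" by metis
  have ii: "inner (\<i> *\<^sub>C u) v = - inner u (\<i> *\<^sub>C v)" for u v :: 'a
    by (simp add: inner_eq_Re_cinner cinner_scaleC_right cinner_scaleC_left)
  have "cinner (T x) y = cinner x (R y)" for x y
  proof (rule complex_eqI)
    show "Re (cinner (T x) y) = Re (cinner x (R y))"
      using R by (simp add: inner_eq_Re_cinner)
    have "inner (T x) (\<i> *\<^sub>C y) = - inner (T (\<i> *\<^sub>C x)) y" by (simp add: sc ii)
    also have "\<dots> = inner x (\<i> *\<^sub>C R y)" by (simp add: R ii)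
    finally show "Im (cinner (T x) y) = Im (cinner x (R y))" by (simp add: Im_cinner)
  qed
  then have ex: "\<exists>!R. \<forall>x y. cinner (T x) y = cinner x (R y)"
    by (metis (no_types, lifting) cinner_eqI ext)
  show ?thesis
    using theI'[OF ex] unfolding cadjoint_def by blast
qed


section \<open>The numerical radius of the semi-inner product given by \<open>A\<close>\<close>

definition A_cinner :: "('a::chilbert_space \<Rightarrow> 'a) \<Rightarrow> 'a \<Rightarrow> 'a \<Rightarrow> complex"
  where "A_cinner A x y = cinner (A x) y"

definition A_norm :: "('a::chilbert_space \<Rightarrow> 'a) \<Rightarrow> 'a \<Rightarrow> real"
  where "A_norm A x = sqrt (Re (A_cinner A x x))"

text \<open>
  The supremum is taken in the nonnegative reals, hence the \<open>0\<close>: it only matters when no \<open>x\<close> has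
  \<open>A_norm A x = 1\<close>, that is for \<open>A = 0\<close>, where the supremum is \<open>0\<close>. As a real supremum this is
  only meaningful if the set is bounded, which is the case
  for \<open>T \<in> A_adjointable A\<close> (\<open>A\<close> positive).
\<close>

definition A_numerical_radius ::
    "('a::chilbert_space \<Rightarrow> 'a) \<Rightarrow> ('a \<Rightarrow> 'a) \<Rightarrow> real"
  where "A_numerical_radius A T = Sup (insert 0 {cmod (A_cinner A (T x) x) |x. A_norm A x = 1})"


section \<open>Operator matrices\<close>

definition op_matrix ::
    "('n::finite \<Rightarrow> 'n \<Rightarrow> 'a::chilbert_space \<Rightarrow> 'a) \<Rightarrow> 'a ^ 'n \<Rightarrow> 'a ^ 'n"
  where "op_matrix S x = (\<chi> i. \<Sum>j\<in>UNIV. S i j (x $ j))"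

definition block_diag :: "('a::chilbert_space \<Rightarrow> 'a) \<Rightarrow> 'a ^ 'n::finite \<Rightarrow> 'a ^ 'n"
  where "block_diag A = op_matrix (\<lambda>i j. if i = j then A else (\<lambda>_. 0))"

text \<open>The indices of type \<^typ>\<open>2\<close> are \<open>1\<close> (first) and \<open>2\<close> (second, equal to \<open>0\<close>).\<close>

definition offdiag2 ::
    "('a::chilbert_space \<Rightarrow> 'a) \<Rightarrow> ('a \<Rightarrow> 'a) \<Rightarrow> 2 \<Rightarrow> 2 \<Rightarrow> 'a \<Rightarrow> 'a"
  where "offdiag2 B C k l =
    (if k = 1 \<and> l = 2 then B else if k = 2 \<and> l = 1 then C else (\<lambda>_. 0))"

end

theory Submission
  imports Defs
begin

text \<open>
  For \<open>x\<close> of unit \<open>block_diag A\<close>-seminorm put \<open>t i = A_norm A (x $ i)\<close>, so that the squares of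
  the \<open>t i\<close> add up to \<open>1\<close>. The quadratic form of the operator matrix at \<open>x\<close> splits into
  diagonal terms and, for \<open>i < j\<close>, pairs of mirror-image off-diagonal terms. A diagonal term is at
  most \<open>a i * (t i)\<^sup>2\<close>, where \<open>a i\<close> is the radius of \<open>S i i\<close>. A pair is at most
  \<open>2 * w i j * t i * t j\<close>, where \<open>w i j\<close> is the radius of the off-diagonal two by two matrix:
  after rescaling, the two components enter with equal seminorm, which turns the bound
  \<open>w * (p\<^sup>2 + q\<^sup>2)\<close> into \<open>2 * w * p * q\<close>
  (lemma \<open>A_cinner_cross_terms_le_numerical_radius\<close>).

  Fix a row \<open>i\<close>. By Cauchy-Schwarz over \<open>j > i\<close>, it contributes at most
  \<open>a i * (t i)\<^sup>2 + 2 * t i * c i * s i\<close>, where \<open>c i\<close> and \<open>s i\<close> are the Euclidean norms of the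
  tails of \<open>w i\<close> and \<open>t\<close>. Since \<open>(t i)\<^sup>2 + (s i)\<^sup>2 \<le> 1\<close>, this is at most the larger eigenvalue
  of the matrix with rows \<open>(a i, c i)\<close> and \<open>(c i, 0)\<close>, which is the summand of the
  theorem (lemma \<open>quadratic_form_le_eigenvalue\<close>).

  The analytic input is that an operator with an \<open>A\<close>-adjoint is bounded for the seminorm
  \<open>A_norm A\<close> (lemma \<open>A_adjointable_A_bounded\<close>). It makes the suprema defining the radii genuine
  upper bounds, and it makes the terms involving a component of seminorm \<open>0\<close> vanish, which
  rescaling does not reach.
\<close>

section \<open>Preliminaries on complex inner products and bounded operators\<close>

lemma cinner_zero_left: "cinner 0 (y::'a::chilbert_space) = 0"
  using cinner_add_left[of 0 0 y] by simp

lemma cinner_sum_left: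
  "cinner (\<Sum>i\<in>I. f i) (y::'a::chilbert_space) = (\<Sum>i\<in>I. cinner (f i) y)"
  by (induction I rule: infinite_finite_induct) (auto simp: cinner_zero_left cinner_add_left)

lemma bounded_operator_bounded_linear: "bounded_operator T \<Longrightarrow> bounded_linear T"
  by (simp add: bounded_operator_def)

lemma bounded_operator_scaleC: "bounded_operator T \<Longrightarrow> T (c *\<^sub>C x) = c *\<^sub>C T x"
  by (simp add: bounded_operator_def)

lemmas bounded_operator_add =
  bounded_operator_bounded_linear [THEN bounded_linear.linear, THEN linear_add]
lemmas bounded_operator_scaleR =
  bounded_operator_bounded_linear [THEN bounded_linear.linear, THEN linear_scale]
lemmas bounded_operator_sum =
  bounded_operator_bounded_linear [THEN bounded_linear.linear, THEN linear_sum]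

section \<open>Real inequalities and a rearranged double sum\<close>

lemma square_le_of_quadratic_nonneg:
  fixes a b c :: real
  assumes nonneg: "\<And>t. 0 \<le> t\<^sup>2 * a + 2 * t * b + c" and a: "0 \<le> a"
  shows "b\<^sup>2 \<le> a * c"
proof (cases "a = 0")
  case True
  have "b = 0"
  proof (rule ccontr)
    assume "b \<noteq> 0"
    \<comment> \<open>For \<open>a = 0\<close> the function of \<open>t\<close> is affine and takes the value \<open>- 1\<close> here.\<close>
    then show False using nonneg[of "- (c + 1) / (2 * b)"] True
      by (simp add: field_simps)
  qed
  then show ?thesis using True by simp
next
  case False
  then have "0 < a" using a by simp
  have "(- b / a)\<^sup>2 * a + 2 * (- b / a) * b + c = (a * c - b\<^sup>2) / a"
    using \<open>0 < a\<close> by (simp add: field_simps power2_eq_square)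
  then have "0 \<le> (a * c - b\<^sup>2) / a" using nonneg[of "- b / a"] by simp
  then show ?thesis using \<open>0 < a\<close> by (simp add: zero_le_divide_iff)
qed

text \<open>
  By convexity of \<open>ln \<circ> u\<close> the ratios \<open>u (Suc k) / u k\<close> increase, so a first ratio above \<open>2 * K\<close>
  would make \<open>u\<close> grow at least like \<open>(2 * K) ^ k\<close>, faster than the bound \<open>C * K ^ k\<close> permits. The
  factor \<open>2\<close> is not optimal; it keeps this comparison of growth rates short.
\<close>

lemma growth_of_log_convex_seq:
  fixes u :: "nat \<Rightarrow> real"
  assumes nonneg: "\<And>k. 0 \<le> u k"
    and convex: "\<And>k. (u (Suc k))\<^sup>2 \<le> u (Suc (Suc k)) * u k"
    and bound: "\<And>k. u k \<le> C * K ^ k" and K: "0 < K"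
  shows "u 1 \<le> 2 * K * u 0"
proof (rule ccontr)
  assume "\<not> ?thesis"
  then have first: "2 * K * u 0 < u 1" by simp
  have "0 \<le> 2 * K * u 0" using nonneg[of 0] K by simp
  then have u1: "0 < u 1" using first by linarith
  have u0: "0 < u 0"
  proof (rule ccontr)
    assume "\<not> 0 < u 0"
    then have "u 0 = 0" using nonneg[of 0] by simp
    then show False using convex[of 0] u1 by simp
  qed
  have step: "0 < u k \<and> 2 * K * u k < u (Suc k)" for k
  proof (induction k)
    case 0
    show ?case using u0 first by simp
  next
    case (Suc k)
    then have pk: "0 < u k" and l: "2 * K * u k < u (Suc k)" by auto
    have "0 < 2 * K * u k" using pk K by simp
    then have pk1: "0 < u (Suc k)" using l by linarith
    have "(2 * K * u (Suc k)) * u k < u (Suc k) * u (Suc k)"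
      using mult_strict_right_mono[OF l pk1] by (simp add: algebra_simps)
    also have "\<dots> \<le> u (Suc (Suc k)) * u k" using convex[of k] by (simp add: power2_eq_square)
    finally show ?case using pk pk1 by simp
  qed
  have lower: "(2 * K) ^ k * u 0 \<le> u k" for k
  proof (induction k)
    case (Suc k)
    have "(2 * K) ^ Suc k * u 0 = 2 * K * ((2 * K) ^ k * u 0)" by simp
    also have "\<dots> \<le> 2 * K * u k" using Suc K by (intro mult_left_mono) auto
    finally show ?case using step[of k] by linarith
  qed simp
  obtain k where k: "C / u 0 < 2 ^ k" using real_arch_pow[of 2] by auto
  have "2 ^ k * u 0 * K ^ k \<le> C * K ^ k"
    using lower[of k] bound[of k] by (simp add: power_mult_distrib algebra_simps)
  then have "2 ^ k * u 0 \<le> C" using K by simp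
  then show False using k u0 by (simp add: field_simps)
qed

text \<open>
  The left side is the quadratic form of the symmetric matrix with rows \<open>(a, c)\<close> and \<open>(c, 0)\<close> at
  \<open>(t, s)\<close>, and the right side is the larger root \<open>l\<close> of its characteristic equation
  \<open>l * (l - a) = c\<^sup>2\<close>. That equation makes \<open>\<bar>c\<bar>\<close> the geometric mean of \<open>l - a\<close> and \<open>l\<close>, so the mixed
  term is absorbed by \<open>(l - a) * t\<^sup>2 + l * s\<^sup>2\<close>.
\<close>

lemma quadratic_form_le_eigenvalue:
  fixes a c t s :: real
  assumes a: "0 \<le> a" and ts: "t\<^sup>2 + s\<^sup>2 \<le> 1"
  shows "a * t\<^sup>2 + 2 * t * (c * s) \<le> 1 / 2 * (a + sqrt (a\<^sup>2 + 4 * c\<^sup>2))"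
proof -
  define r where "r = sqrt (a\<^sup>2 + 4 * c\<^sup>2)"
  define l where "l = 1 / 2 * (a + r)"
  have r2: "r\<^sup>2 = a\<^sup>2 + 4 * c\<^sup>2" by (simp add: r_def)
  have "a \<le> r" unfolding r_def by (rule real_le_rsqrt) simp
  then have l: "a \<le> l" by (simp add: l_def)
  have det: "l * (l - a) = c\<^sup>2" using r2 by (simp add: l_def power2_eq_square field_simps)
  have cs: "\<bar>c\<bar> = sqrt (l - a) * sqrt l"
    using det by (metis mult.commute real_sqrt_abs real_sqrt_mult)
  have "t * (c * s) \<le> \<bar>t * (c * s)\<bar>" by simp
  also have "\<dots> = (sqrt (l - a) * \<bar>t\<bar>) * (sqrt l * \<bar>s\<bar>)" by (simp add: abs_mult cs)
  finally have "2 * t * (c * s) \<le> 2 * (sqrt (l - a) * \<bar>t\<bar>) * (sqrt l * \<bar>s\<bar>)" by simp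
  also have "\<dots> \<le> (sqrt (l - a) * \<bar>t\<bar>)\<^sup>2 + (sqrt l * \<bar>s\<bar>)\<^sup>2" by (rule sum_squares_bound)
  also have "\<dots> = (l - a) * t\<^sup>2 + l * s\<^sup>2" using l a by (simp add: power_mult_distrib)
  finally have "a * t\<^sup>2 + 2 * t * (c * s) \<le> l * (t\<^sup>2 + s\<^sup>2)" by (simp add: algebra_simps)
  also have "\<dots> \<le> l" using ts l a by (simp add: mult_left_le)
  finally show ?thesis by (simp add: l_def r_def)
qed

lemma sum_pairs_split_diagonal:
  fixes f :: "'n::{finite, linorder} \<Rightarrow> 'n \<Rightarrow> 'b::comm_monoid_add"
  shows "(\<Sum>i\<in>UNIV. \<Sum>j\<in>UNIV. f i j) =
    (\<Sum>i\<in>UNIV. f i i + (\<Sum>j\<in>{i<..}. f i j + f j i))"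
proof -
  have row: "(\<Sum>j\<in>UNIV. f i j) = f i i + (\<Sum>j\<in>{i<..}. f i j) + (\<Sum>j\<in>{..<i}. f i j)" for i
  proof -
    have "UNIV = insert i ({i<..} \<union> {..<i})" by auto
    then have "(\<Sum>j\<in>UNIV. f i j) = (\<Sum>j\<in>insert i ({i<..} \<union> {..<i}). f i j)" by simp
    also have "\<dots> = f i i + (\<Sum>j\<in>{i<..} \<union> {..<i}. f i j)" by (rule sum.insert) auto
    also have "(\<Sum>j\<in>{i<..} \<union> {..<i}. f i j) = (\<Sum>j\<in>{i<..}. f i j) + (\<Sum>j\<in>{..<i}. f i j)"
      by (rule sum.union_disjoint) auto
    finally show ?thesis by (simp add: add.assoc)
  qed
  have "(\<Sum>i\<in>UNIV. \<Sum>j\<in>{..<i}. f i j) = (\<Sum>j\<in>UNIV. \<Sum>i\<in>{j<..}. f i j)"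
    using sum.swap_restrict[of UNIV UNIV f "\<lambda>i j. j < i"]
    by (simp add: lessThan_def greaterThan_def)
  then show ?thesis by (simp add: row sum.distrib add.assoc)
qed

section \<open>The semi-inner product of a positive operator\<close>

lemma block_diag_nth:
  "block_diag A x $ i = A (x $ i)"
proof -
  have "block_diag A x $ i = (\<Sum>j\<in>UNIV. if i = j then A (x $ j) else 0)"
    unfolding block_diag_def op_matrix_def by (simp add: if_distrib[of "\<lambda>g. g _"] cong: if_cong)
  then show ?thesis by simp
qed

text \<open>
  On the reals \<open>Sup\<close> bounds only sets that are bounded above, so the basic properties of
  the numerical radius depend on some bound \<open>K\<close> being known, whatever its value.
\<close>

lemma A_numerical_radius_upper:
  assumes bound: "\<And>y. A_norm A y = 1 \<Longrightarrow> cmod (A_cinner A (T y) y) \<le> K"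
  shows "0 \<le> A_numerical_radius A T"
    and "A_norm A x = 1 \<Longrightarrow> cmod (A_cinner A (T x) x) \<le> A_numerical_radius A T"
proof -
  have bdd: "bdd_above (insert 0 {cmod (A_cinner A (T x) x) |x. A_norm A x = 1})"
    by (rule bdd_aboveI[of _ "max 0 K"]) (auto dest: bound)
  show "0 \<le> A_numerical_radius A T"
    unfolding A_numerical_radius_def by (rule cSup_upper[OF _ bdd]) simp
  show "A_norm A x = 1 \<Longrightarrow> cmod (A_cinner A (T x) x) \<le> A_numerical_radius A T"
    unfolding A_numerical_radius_def by (rule cSup_upper[OF _ bdd]) auto
qed

context
  fixes A :: "'a::chilbert_space \<Rightarrow> 'a"
  assumes A: "positive_operator A"
begin

lemma A_bounded_operator: "bounded_operator A"
  using A by (simp add: positive_operator_def)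

lemma A_cinner_self_real: "Im (A_cinner A x x) = 0"
  using A by (auto simp: positive_operator_def A_cinner_def complex_is_Real_iff)

lemma A_cinner_self_nonneg: "0 \<le> Re (A_cinner A x x)"
  using A by (simp add: positive_operator_def A_cinner_def)

lemma A_norm_nonneg: "0 \<le> A_norm A x"
  by (simp add: A_norm_def A_cinner_self_nonneg)

lemma A_norm_square: "(A_norm A x)\<^sup>2 = Re (A_cinner A x x)"
  by (simp add: A_norm_def A_cinner_self_nonneg)

lemma A_cinner_add_left: "A_cinner A (x + y) z = A_cinner A x z + A_cinner A y z"
  by (simp add: A_cinner_def bounded_operator_add[OF A_bounded_operator] cinner_add_left)

lemma A_cinner_add_right: "A_cinner A x (y + z) = A_cinner A x y + A_cinner A x z"
  by (simp add: A_cinner_def cinner_add_right)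

lemma A_cinner_scaleC_left: "A_cinner A (c *\<^sub>C x) y = c * A_cinner A x y"
  by (simp add: A_cinner_def bounded_operator_scaleC[OF A_bounded_operator] cinner_scaleC_left)

lemma A_cinner_scaleC_right: "A_cinner A x (c *\<^sub>C y) = cnj c * A_cinner A x y"
  by (simp add: A_cinner_def cinner_scaleC_right)

lemma A_cinner_scaleR_left: "A_cinner A (r *\<^sub>R x) y = of_real r * A_cinner A x y"
  by (simp add: scaleR_eq_scaleC A_cinner_scaleC_left)

lemma A_cinner_scaleR_right: "A_cinner A x (r *\<^sub>R y) = of_real r * A_cinner A x y"
  by (simp add: scaleR_eq_scaleC A_cinner_scaleC_right)

lemma A_cinner_sum_left: "A_cinner A (\<Sum>i\<in>I. f i) y = (\<Sum>i\<in>I. A_cinner A (f i) y)"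
  by (simp add: A_cinner_def bounded_operator_sum[OF A_bounded_operator] cinner_sum_left)

lemma A_norm_scaleR: "A_norm A (r *\<^sub>R x) = \<bar>r\<bar> * A_norm A x"
  by (simp add: A_norm_def A_cinner_scaleR_left A_cinner_scaleR_right real_sqrt_mult)

text \<open>
  Polarization: the form is real on the diagonal, and evaluating it at \<open>x + y\<close> and at
  \<open>x + \<i> *\<^sub>C y\<close> gives the imaginary and the real part of the symmetry.
\<close>

lemma A_cinner_commute: "A_cinner A x y = cnj (A_cinner A y x)"
proof (rule complex_eqI)
  show "Im (A_cinner A x y) = Im (cnj (A_cinner A y x))"
    using A_cinner_self_real[of "x + y"] A_cinner_self_real[of x] A_cinner_self_real[of y]
    by (simp add: A_cinner_add_left A_cinner_add_right)
  show "Re (A_cinner A x y) = Re (cnj (A_cinner A y x))"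
    using A_cinner_self_real[of "x + \<i> *\<^sub>C y"] A_cinner_self_real[of x] A_cinner_self_real[of y]
    by (simp add: A_cinner_add_left A_cinner_add_right A_cinner_scaleC_left A_cinner_scaleC_right)
qed

lemma A_cinner_cauchy_schwarz: "cmod (A_cinner A x y) \<le> A_norm A x * A_norm A y"
proof -
  have re: "(Re (A_cinner A u v))\<^sup>2 \<le> (A_norm A u * A_norm A v)\<^sup>2" for u v
  proof -
    have "0 \<le> t\<^sup>2 * Re (A_cinner A u u) + 2 * t * Re (A_cinner A u v) + Re (A_cinner A v v)" for t
      using A_cinner_self_nonneg[of "t *\<^sub>R u + v"] A_cinner_commute[of v u]
      by (simp add: A_cinner_add_left A_cinner_add_right A_cinner_scaleR_left
          A_cinner_scaleR_right power2_eq_square algebra_simps)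
    from square_le_of_quadratic_nonneg[OF this A_cinner_self_nonneg] show ?thesis
      by (simp add: power_mult_distrib A_norm_square)
  qed
  \<comment> \<open>A unimodular factor \<open>c\<close> on \<open>x\<close> turns the modulus of \<open>z\<close> into a real part.\<close>
  define z where "z = A_cinner A x y"
  show ?thesis
  proof (cases "z = 0")
    case True
    then show ?thesis by (simp add: z_def[symmetric] A_norm_nonneg)
  next
    case False
    define c where "c = cnj z / cmod z"
    have cz: "c * z = cmod z" and cc: "cnj c * c = 1"
      using False complex_norm_square[of z] by (auto simp: c_def power2_eq_square field_simps)
    have "A_norm A (c *\<^sub>C x) = A_norm A x"
      unfolding A_norm_def A_cinner_scaleC_left A_cinner_scaleC_right mult.assoc[symmetric] cc
      by (simp only: mult_1)
    moreover have "Re (A_cinner A (c *\<^sub>C x) y) = cmod z"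
      unfolding A_cinner_scaleC_left z_def[symmetric] cz by (rule Re_complex_of_real)
    ultimately have "(cmod z)\<^sup>2 \<le> (A_norm A x * A_norm A y)\<^sup>2"
      using re[of "c *\<^sub>C x" y] by simp
    then show ?thesis unfolding z_def
      by (rule power2_le_imp_le) (simp add: A_norm_nonneg)
  qed
qed

lemma A_norm_le_norm: obtains a where "0 \<le> a" "\<And>x. A_norm A x \<le> a * norm x"
proof -
  obtain b where b: "0 < b" "\<And>x. norm (A x) \<le> norm x * b"
    using bounded_linear.pos_bounded[OF bounded_operator_bounded_linear[OF A_bounded_operator]]
    by blast
  have "A_norm A x \<le> sqrt b * norm x" for x
  proof -
    have "Re (A_cinner A x x) = inner (A x) x" by (simp add: A_cinner_def inner_eq_Re_cinner)
    also have "\<dots> \<le> norm (A x) * norm x" by (rule norm_cauchy_schwarz)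
    also have "\<dots> \<le> norm x * b * norm x" by (intro mult_right_mono b) simp
    also have "\<dots> = (sqrt b * norm x)\<^sup>2" using b by (simp add: power_mult_distrib power2_eq_square)
    finally show ?thesis unfolding A_norm_def using b by (intro real_le_lsqrt) auto
  qed
  then show ?thesis using b by (intro that[of "sqrt b"]) auto
qed

section \<open>Operators with an \<open>A\<close>-adjoint are \<open>A\<close>-bounded\<close>

text \<open>
  If \<open>X\<close> is an \<open>A\<close>-adjoint of \<open>T\<close>, then \<open>B = X \<circ> T\<close> is symmetric for the semi-inner product.
  By Cauchy-Schwarz the seminorms of the iterates \<open>(B ^^ k) x\<close> are therefore log-convex in \<open>k\<close>,
  while boundedness of \<open>A\<close> and \<open>B\<close> in the Hilbert norm makes them grow at most exponentially, at a
  rate independent of \<open>x\<close>. This bounds \<open>B\<close> in the seminorm, and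
  \<open>(A_norm A (T x))\<^sup>2 = Re (A_cinner A (B x) x)\<close> carries the bound over to \<open>T\<close>.
\<close>

lemma A_adjointable_A_bounded:
  assumes "T \<in> A_adjointable A"
  obtains K where "0 \<le> K" "\<And>x. A_norm A (T x) \<le> K * A_norm A x"
proof -
  obtain X where T: "bounded_operator T" and X: "bounded_operator X"
    and AX: "A \<circ> X = cadjoint T \<circ> A"
    using assms by (auto simp: A_adjointable_def)
  have adj: "A_cinner A (X u) v = A_cinner A u (T v)" for u v
  proof -
    have "A_cinner A (X u) v = cinner (cadjoint T (A u)) v"
      using AX by (simp add: A_cinner_def fun_eq_iff)
    also have "\<dots> = cnj (cinner v (cadjoint T (A u)))" by (rule cinner_commute)
    also have "\<dots> = cnj (cinner (T v) (A u))" by (simp only: cadjoint[OF T])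
    also have "\<dots> = cinner (A u) (T v)" by (rule cinner_commute[symmetric])
    finally show ?thesis by (simp only: A_cinner_def)
  qed
  define B where "B = X \<circ> T"
  have B: "bounded_linear B"
    unfolding B_def comp_def
    by (rule bounded_linear_compose; intro bounded_operator_bounded_linear T X)
  have sym: "A_cinner A (B u) v = A_cinner A u (B v)" for u v
  proof -
    have "A_cinner A (B u) v = A_cinner A (T u) (T v)" by (simp add: B_def adj)
    also have "\<dots> = cnj (A_cinner A (T v) (T u))" by (rule A_cinner_commute)
    also have "\<dots> = cnj (A_cinner A (B v) u)" by (simp add: B_def adj)
    also have "\<dots> = A_cinner A u (B v)" by (rule A_cinner_commute[symmetric])
    finally show ?thesis .
  qed
  obtain K where K: "0 < K" "\<And>x. norm (B x) \<le> norm x * K"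
    using bounded_linear.pos_bounded[OF B] by blast
  obtain a where a: "0 \<le> a" "\<And>x. A_norm A x \<le> a * norm x" using A_norm_le_norm by blast
  have B_bound: "A_norm A (B x) \<le> 2 * K * A_norm A x" for x
  proof -
    have iterate: "norm ((B ^^ k) x) \<le> norm x * K ^ k" for k
    proof (induction k)
      case (Suc k)
      have "norm ((B ^^ Suc k) x) \<le> norm ((B ^^ k) x) * K" using K by simp
      also have "\<dots> \<le> norm x * K ^ k * K" using Suc K by (intro mult_right_mono) auto
      finally show ?case by (simp add: algebra_simps)
    qed simp
    have bound: "A_norm A ((B ^^ k) x) \<le> (a * norm x) * K ^ k" for k
      using order_trans[OF a(2) mult_left_mono[OF iterate a(1)], of k] by (simp add: mult.assoc)
    have convex: "(A_norm A ((B ^^ Suc k) x))\<^sup>2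
        \<le> A_norm A ((B ^^ Suc (Suc k)) x) * A_norm A ((B ^^ k) x)" for k
    proof -
      have "(A_norm A ((B ^^ Suc k) x))\<^sup>2 = Re (A_cinner A ((B ^^ Suc (Suc k)) x) ((B ^^ k) x))"
        by (simp add: A_norm_square sym)
      also have "\<dots> \<le> cmod (A_cinner A ((B ^^ Suc (Suc k)) x) ((B ^^ k) x))"
        by (rule complex_Re_le_cmod)
      also note A_cinner_cauchy_schwarz
      finally show ?thesis .
    qed
    from growth_of_log_convex_seq[of "\<lambda>k. A_norm A ((B ^^ k) x)", OF A_norm_nonneg convex bound K(1)]
    show ?thesis by simp
  qed
  have "A_norm A (T x) \<le> sqrt (2 * K) * A_norm A x" for x
  proof (rule power2_le_imp_le)
    have "(A_norm A (T x))\<^sup>2 = Re (A_cinner A (B x) x)" by (simp add: A_norm_square B_def adj)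
    also have "\<dots> \<le> cmod (A_cinner A (B x) x)" by (rule complex_Re_le_cmod)
    also have "\<dots> \<le> A_norm A (B x) * A_norm A x" by (rule A_cinner_cauchy_schwarz)
    also have "\<dots> \<le> 2 * K * A_norm A x * A_norm A x"
      by (intro mult_right_mono B_bound A_norm_nonneg)
    also have "\<dots> = (sqrt (2 * K) * A_norm A x)\<^sup>2"
      using K(1) by (simp add: power_mult_distrib power2_eq_square)
    finally show "(A_norm A (T x))\<^sup>2 \<le> (sqrt (2 * K) * A_norm A x)\<^sup>2" .
    show "0 \<le> sqrt (2 * K) * A_norm A x" using K(1) by (simp add: A_norm_nonneg)
  qed
  then show ?thesis using K(1) by (intro that[of "sqrt (2 * K)"]) auto
qed

lemma A_adjointable_form_bounded:
  assumes "T \<in> A_adjointable A"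
  obtains K where "0 \<le> K" "\<And>x y. cmod (A_cinner A (T x) y) \<le> K * A_norm A x * A_norm A y"
proof -
  obtain K where K: "0 \<le> K" "\<And>x. A_norm A (T x) \<le> K * A_norm A x"
    using A_adjointable_A_bounded[OF assms] by blast
  have "cmod (A_cinner A (T x) y) \<le> K * A_norm A x * A_norm A y" for x y
    using A_cinner_cauchy_schwarz[of "T x" y] mult_right_mono[OF K(2)[of x] A_norm_nonneg[of y]]
    by linarith
  then show ?thesis using K(1) that by blast
qed

section \<open>Bounds by numerical radii\<close>

lemma A_cinner_op_matrix:
  "A_cinner (block_diag A) (op_matrix S x) x =
    (\<Sum>i\<in>UNIV. \<Sum>j\<in>UNIV. A_cinner A (S i j (x $ j)) (x $ i))"
  by (simp add: A_cinner_def cinner_vec_def block_diag_nth op_matrix_def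
      bounded_operator_sum[OF A_bounded_operator] cinner_sum_left)

lemma A_norm_block_diag_square:
  "(A_norm (block_diag A) x)\<^sup>2 = (\<Sum>i\<in>UNIV. (A_norm A (x $ i))\<^sup>2)"
proof -
  have eq: "Re (A_cinner (block_diag A) x x) = (\<Sum>i\<in>UNIV. (A_norm A (x $ i))\<^sup>2)"
    unfolding A_norm_square by (simp add: A_cinner_def cinner_vec_def block_diag_nth)
  have "0 \<le> (\<Sum>i\<in>UNIV. (A_norm A (x $ i))\<^sup>2)" by (simp add: sum_nonneg)
  then show ?thesis by (simp add: A_norm_def[of "block_diag A"] eq)
qed

lemma A_numerical_range_bounded:
  assumes T: "T \<in> A_adjointable A"
  obtains K where "\<And>y. A_norm A y = 1 \<Longrightarrow> cmod (A_cinner A (T y) y) \<le> K"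
proof -
  obtain K where "\<And>x y. cmod (A_cinner A (T x) y) \<le> K * A_norm A x * A_norm A y"
    using A_adjointable_form_bounded[OF T] by blast
  then have "cmod (A_cinner A (T y) y) \<le> K" if "A_norm A y = 1" for y
    using that by (metis mult_1_right)
  then show ?thesis using that by blast
qed

lemma A_cinner_le_numerical_radius:
  assumes T: "T \<in> A_adjointable A"
  shows "cmod (A_cinner A (T x) x) \<le> A_numerical_radius A T * (A_norm A x)\<^sup>2"
proof -
  show ?thesis
  proof (cases "A_norm A x = 0")
    case True
    obtain K where "cmod (A_cinner A (T x) x) \<le> K * A_norm A x * A_norm A x"
      using A_adjointable_form_bounded[OF T] by metis
    then show ?thesis using True by simp
  next
    case False
    define p where "p = A_norm A x"
    have p: "0 < p" using False A_norm_nonneg[of x] by (simp add: p_def)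
    define u where "u = (1 / p) *\<^sub>R x"
    have u: "A_norm A u = 1" using p by (simp add: u_def A_norm_scaleR p_def[symmetric])
    obtain K where K: "\<And>y. A_norm A y = 1 \<Longrightarrow> cmod (A_cinner A (T y) y) \<le> K"
      using A_numerical_range_bounded[OF T] by blast
    have "cmod (A_cinner A (T u) u) \<le> A_numerical_radius A T"
      by (rule A_numerical_radius_upper(2)[OF K u])
    moreover have "A_cinner A (T u) u = of_real (1 / p\<^sup>2) * A_cinner A (T x) x"
      using T by (simp add: u_def A_adjointable_def bounded_operator_scaleR A_cinner_scaleR_left
          A_cinner_scaleR_right power2_eq_square)
    ultimately have "1 / p\<^sup>2 * cmod (A_cinner A (T x) x) \<le> A_numerical_radius A T"
      by (simp add: norm_mult norm_divide norm_power)
    then show ?thesis using p by (simp add: p_def[symmetric] field_simps)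
  qed
qed

lemma A_cinner_offdiag2:
  "A_cinner (block_diag A) (op_matrix (offdiag2 B C) z) z =
    A_cinner A (B (z $ 2)) (z $ 1) + A_cinner A (C (z $ 1)) (z $ 2)"
proof -
  have "A_cinner A 0 y = 0" for y using A_cinner_scaleR_left[of 0 0 y] by simp
  then show ?thesis by (simp add: A_cinner_op_matrix offdiag2_def sum_2)
qed

text \<open>
  The off-diagonal matrix is tested at the vector \<open>z\<close> whose two components are \<open>x\<close> and \<open>y\<close>
  rescaled to seminorm \<open>1 / sqrt 2\<close> each, so that \<open>z\<close> has seminorm \<open>1\<close>. If one of \<open>x\<close>, \<open>y\<close> has
  seminorm \<open>0\<close>, both terms on the left vanish by \<open>A\<close>-boundedness.
\<close>

lemma A_cinner_cross_terms_le_numerical_radius: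
  assumes B: "B \<in> A_adjointable A" and C: "C \<in> A_adjointable A"
  shows "cmod (A_cinner A (B y) x + A_cinner A (C x) y) \<le>
    2 * A_numerical_radius (block_diag A) (op_matrix (offdiag2 B C)) * A_norm A x * A_norm A y"
    (is "_ \<le> 2 * ?w * _ * _")
proof -
  obtain K where K: "0 \<le> K" "\<And>x y. cmod (A_cinner A (B x) y) \<le> K * A_norm A x * A_norm A y"
    using A_adjointable_form_bounded[OF B] by blast
  obtain L where L: "0 \<le> L" "\<And>x y. cmod (A_cinner A (C x) y) \<le> L * A_norm A x * A_norm A y"
    using A_adjointable_form_bounded[OF C] by blast
  have sum_bound: "cmod (A_cinner A (B y) x + A_cinner A (C x) y)
      \<le> (K + L) * (A_norm A x * A_norm A y)" for x y
    using norm_triangle_ineq[of "A_cinner A (B y) x" "A_cinner A (C x) y"] K(2)[of y x] L(2)[of x y]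
    by (simp add: algebra_simps)
  show ?thesis
  proof (cases "A_norm A x = 0 \<or> A_norm A y = 0")
    case True
    then show ?thesis using sum_bound[of y x] by auto
  next
    case False
    define p q where "p = A_norm A x" and "q = A_norm A y"
    have p: "0 < p" and q: "0 < q"
      using False A_norm_nonneg[of x] A_norm_nonneg[of y] by (auto simp: p_def q_def)
    define z :: "'a ^ 2" where
      "z = (\<chi> i. if i = 1 then (1 / (sqrt 2 * p)) *\<^sub>R x else (1 / (sqrt 2 * q)) *\<^sub>R y)"
    have z: "z $ 1 = (1 / (sqrt 2 * p)) *\<^sub>R x" "z $ 2 = (1 / (sqrt 2 * q)) *\<^sub>R y"
      by (simp_all add: z_def)
    have "(A_norm (block_diag A) z)\<^sup>2 = 1"
      using p q by (simp add: A_norm_block_diag_square sum_2 z A_norm_scaleR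
          p_def[symmetric] q_def[symmetric] power_divide power_mult_distrib)
    moreover have "0 \<le> A_norm (block_diag A) z"
    proof -
      have "0 \<le> Re (A_cinner (block_diag A) z z)"
        by (simp add: A_cinner_def cinner_vec_def block_diag_nth sum_nonneg
            A_cinner_self_nonneg[unfolded A_cinner_def])
      then show ?thesis by (simp add: A_norm_def)
    qed
    ultimately have z1: "A_norm (block_diag A) z = 1" by (simp add: power2_eq_1_iff)
    have bdd: "cmod (A_cinner (block_diag A) (op_matrix (offdiag2 B C) v) v) \<le> K + L"
      if v: "A_norm (block_diag A) v = 1" for v :: "'a ^ 2"
    proof -
      have "(A_norm A (v $ 1))\<^sup>2 + (A_norm A (v $ 2))\<^sup>2 = 1"
        using A_norm_block_diag_square[of v] v by (simp add: sum_2)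
      then have "(A_norm A (v $ 1))\<^sup>2 \<le> 1\<^sup>2" "(A_norm A (v $ 2))\<^sup>2 \<le> 1\<^sup>2"
        by (smt (verit) one_power2 zero_le_power2)+
      then have "A_norm A (v $ 1) \<le> 1" "A_norm A (v $ 2) \<le> 1"
        by (auto intro: power2_le_imp_le)
      then have "A_norm A (v $ 1) * A_norm A (v $ 2) \<le> 1"
        by (simp add: A_norm_nonneg mult_le_one)
      then have "(K + L) * (A_norm A (v $ 1) * A_norm A (v $ 2)) \<le> K + L"
        using K(1) L(1) by (simp add: mult_left_le)
      then show ?thesis
        using sum_bound[of "v $ 2" "v $ 1"] by (simp add: A_cinner_offdiag2)
    qed
    have "cmod (A_cinner (block_diag A) (op_matrix (offdiag2 B C) z) z) \<le> ?w"
      by (rule A_numerical_radius_upper(2)[OF bdd z1])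
    moreover have "A_cinner (block_diag A) (op_matrix (offdiag2 B C) z) z
      = of_real (1 / (2 * p * q)) * (A_cinner A (B y) x + A_cinner A (C x) y)"
    proof -
      have lin: "B (r *\<^sub>R v) = r *\<^sub>R B v" "C (r *\<^sub>R v) = r *\<^sub>R C v" for r v
        using B C by (auto simp: A_adjointable_def bounded_operator_scaleR)
      have half: "complex_of_real (1 / (sqrt 2 * p)) * complex_of_real (1 / (sqrt 2 * q))
          = of_real (1 / (2 * p * q))"
        unfolding of_real_mult[symmetric] by (simp add: field_simps)
      show ?thesis
        unfolding A_cinner_offdiag2 z lin A_cinner_scaleR_left A_cinner_scaleR_right half[symmetric]
        by (simp only: algebra_simps)
    qed
    ultimately have "1 / (2 * p * q) * cmod (A_cinner A (B y) x + A_cinner A (C x) y) \<le> ?w"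
      using p q by (simp only: norm_mult norm_of_real) simp
    then show ?thesis using p q by (simp add: p_def[symmetric] q_def[symmetric] field_simps)
  qed
qed

end


section \<open>The bound for operator matrices\<close>

theorem theorem4p2:
  fixes A :: "'h::chilbert_space \<Rightarrow> 'h"
    and S :: "'n::{finite, linorder} \<Rightarrow> 'n \<Rightarrow> 'h \<Rightarrow> 'h"
  assumes "positive_operator A"
    and "\<And>i j. S i j \<in> A_adjointable A"
  shows "A_numerical_radius (block_diag A) (op_matrix S) \<le>
    1 / 2 * (\<Sum>i\<in>UNIV. A_numerical_radius A (S i i) +
      sqrt ((A_numerical_radius A (S i i))\<^sup>2 +
        4 * (\<Sum>j\<in>{i<..}. (A_numerical_radius (block_diag A)
          (op_matrix (offdiag2 (S i j) (S j i))))\<^sup>2)))"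
proof -
  define a where "a i = A_numerical_radius A (S i i)" for i
  define w where "w i j = A_numerical_radius (block_diag A :: 'h ^ 2 \<Rightarrow> 'h ^ 2)
    (op_matrix (offdiag2 (S i j) (S j i)))" for i j
  define c where "c i = L2_set (w i) {i<..}" for i
  have c2: "(c i)\<^sup>2 = (\<Sum>j\<in>{i<..}. (w i j)\<^sup>2)" for i
    by (simp add: c_def L2_set_def sum_nonneg)
  have a_nonneg: "0 \<le> a i" for i
    unfolding a_def
    using A_numerical_range_bounded[OF assms] A_numerical_radius_upper(1) by metis
  have "A_numerical_radius (block_diag A) (op_matrix S) \<le>
    (\<Sum>i\<in>UNIV. 1 / 2 * (a i + sqrt ((a i)\<^sup>2 + 4 * (c i)\<^sup>2)))" (is "_ \<le> ?R")
    unfolding A_numerical_radius_def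
  proof (rule cSup_least)
    fix v
    assume "v \<in> insert 0 {cmod (A_cinner (block_diag A) (op_matrix S x) x)
      |x. A_norm (block_diag A) x = 1}"
    then consider "v = 0" | x where "v = cmod (A_cinner (block_diag A) (op_matrix S x) x)"
      "A_norm (block_diag A) x = 1" by blast
    then show "v \<le> ?R"
    proof cases
      case 1
      then show ?thesis by (simp add: sum_nonneg a_nonneg)
    next
      case (2 x)
      define t where "t i = A_norm A (x $ i)" for i
      define s where "s i = L2_set t {i<..}" for i
      have t_nonneg: "0 \<le> t i" for i by (simp add: t_def A_norm_nonneg[OF assms(1)])
      have t_unit: "(\<Sum>i\<in>UNIV. (t i)\<^sup>2) = 1"
        using A_norm_block_diag_square[OF assms(1), of x] 2 by (simp add: t_def)
      have ts: "(t i)\<^sup>2 + (s i)\<^sup>2 \<le> 1" for i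
      proof -
        have "(t i)\<^sup>2 + (s i)\<^sup>2 = (\<Sum>j\<in>insert i {i<..}. (t j)\<^sup>2)"
          by (simp add: s_def L2_set_def sum_nonneg)
        also have "\<dots> \<le> (\<Sum>j\<in>UNIV. (t j)\<^sup>2)" by (rule sum_mono2) auto
        finally show ?thesis by (simp add: t_unit)
      qed
      define f where "f i j = A_cinner A (S i j (x $ j)) (x $ i)" for i j
      have "v = cmod (\<Sum>i\<in>UNIV. f i i + (\<Sum>j\<in>{i<..}. f i j + f j i))"
        unfolding 2 A_cinner_op_matrix[OF assms(1)] f_def[symmetric] sum_pairs_split_diagonal ..
      also have "\<dots> \<le> (\<Sum>i\<in>UNIV. cmod (f i i) + (\<Sum>j\<in>{i<..}. cmod (f i j + f j i)))"
        by (intro sum_norm_le norm_triangle_mono order_refl)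
      also have "\<dots> \<le> ?R"
      proof (rule sum_mono)
        fix i :: 'n
        have "(\<Sum>j\<in>{i<..}. cmod (f i j + f j i)) \<le> (\<Sum>j\<in>{i<..}. 2 * t i * (\<bar>w i j\<bar> * \<bar>t j\<bar>))"
        proof (rule sum_mono)
          fix j
          have "cmod (f i j + f j i) \<le> 2 * w i j * t i * t j"
            using A_cinner_cross_terms_le_numerical_radius[OF assms(1) assms(2) assms(2)]
            unfolding f_def w_def t_def .
          also have "\<dots> = 2 * t i * t j * w i j" by simp
          also have "\<dots> \<le> 2 * t i * t j * \<bar>w i j\<bar>" by (intro mult_left_mono) (simp_all add: t_nonneg)
          finally show "cmod (f i j + f j i) \<le> 2 * t i * (\<bar>w i j\<bar> * \<bar>t j\<bar>)"
            by (simp add: t_nonneg algebra_simps)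
        qed
        also have "\<dots> = 2 * t i * (\<Sum>j\<in>{i<..}. \<bar>w i j\<bar> * \<bar>t j\<bar>)" by (simp add: sum_distrib_left)
        also have "\<dots> \<le> 2 * t i * (c i * s i)"
          unfolding c_def s_def by (intro mult_left_mono L2_set_mult_ineq) (simp add: t_nonneg)
        finally have "(\<Sum>j\<in>{i<..}. cmod (f i j + f j i)) \<le> 2 * t i * (c i * s i)" .
        moreover have "cmod (f i i) \<le> a i * (t i)\<^sup>2"
          unfolding f_def a_def t_def by (rule A_cinner_le_numerical_radius[OF assms])
        ultimately have "cmod (f i i) + (\<Sum>j\<in>{i<..}. cmod (f i j + f j i))
          \<le> a i * (t i)\<^sup>2 + 2 * t i * (c i * s i)" by linarith
        also have "\<dots> \<le> 1 / 2 * (a i + sqrt ((a i)\<^sup>2 + 4 * (c i)\<^sup>2))"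
          by (rule quadratic_form_le_eigenvalue[OF a_nonneg ts])
        finally show "cmod (f i i) + (\<Sum>j\<in>{i<..}. cmod (f i j + f j i))
          \<le> 1 / 2 * (a i + sqrt ((a i)\<^sup>2 + 4 * (c i)\<^sup>2))" .
      qed
      finally show ?thesis .
    qed
  qed simp
  then show ?thesis by (simp only: a_def w_def c2 sum_distrib_left)
qed

end
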